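(* Let $p$ be an odd prime. Then $$2\,C_{\rm sd}(p)=C_{\rm u}(p)+C_{\rm su}(p).$$ In particular, if $p\equiv 3 \pmod 4$, then $$C_{\rm u}(p)=2\,C_{\rm sd}(p)=2\,C_{\rm t}(p).$$
   Context: All graphs are simple (no loops, no multiple edges or arcs). An undirected edge is identified with the pair of oppositely directed arcs, so undirected graphs are regarded as symmetric digraphs. A circulant (graph) of order $n$ is a digraph on the vertex set $\mathbb{Z}_n=\{0,1,\dots,n-1\}$ invariant under the cyclic permutation $v\mapsto v+1 \pmod n$ (equivalently, a Cayley digraph of the cyclic group $\mathbb{Z}_n$). A digraph is a tournament if for every two distinct vertices $u,v$ exactly one of the arcs $(u,v),(v,u)$ is present. The complement of a digraph has the same vertices and, for distinct $u,v$, the arc $(u,v)$ exactly when the original does not; a digraph is self-complementary if it is isomorphic to its complement. All enumerators count isomorphism classes of graphs (isomorphism as digraphs): $C_{\rm u}(n)$ is the number of undirected circulants of order $n$; $C_{\rm sd}(n)$ is the number of self-complementary directed circulants of order $n$ (symmetric ones and tournaments included); $C_{\rm su}(n)$ is the number of self-complementary undirected circulants of order $n$; $C_{\rm t}(n)$ is the number of circulant tournaments of order $n$. *)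

theory Defs
  imports
    "HOL-Computational_Algebra.Primes"
    "Graph_Theory.Pair_Digraph"
    "Graph_Theory.Digraph_Isomorphism"
begin

text \<open>
  \<^const>\<open>pair_digraph\<close> is a finite digraph without loops and multiple arcs, so undirected
  graphs are exactly the \<^const>\<open>symmetric\<close> ones. The set of residues modulo n is represented
  by {..<n} (for n > 0).
\<close>

definition circulant :: "nat \<Rightarrow> nat pair_pre_digraph \<Rightarrow> bool" where
  "circulant n G \<longleftrightarrow> pair_digraph G \<and> pverts G = {..<n} \<and>
     (\<lambda>(u, v). ((u + 1) mod n, (v + 1) mod n)) ` parcs G = parcs G"

definition tournament :: "'a pair_pre_digraph \<Rightarrow> bool" where
  "tournament G \<longleftrightarrow> pair_digraph G \<and>
     (\<forall>u\<in>pverts G. \<forall>v\<in>pverts G. u \<noteq> v \<longrightarrow> ((u, v) \<in> parcs G) \<noteq> ((v, u) \<in> parcs G))"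

definition isomorphic :: "'a pair_pre_digraph \<Rightarrow> 'b pair_pre_digraph \<Rightarrow> bool" where
  "isomorphic G H \<longleftrightarrow> digraph_iso (with_proj G) (with_proj H)"

definition digraph_complement :: "'a pair_pre_digraph \<Rightarrow> 'a pair_pre_digraph" where
  "digraph_complement G = \<lparr> pverts = pverts G,
     parcs = {(u, v). u \<in> pverts G \<and> v \<in> pverts G \<and> u \<noteq> v \<and> (u, v) \<notin> parcs G} \<rparr>"

definition self_complementary :: "'a pair_pre_digraph \<Rightarrow> bool" where
  "self_complementary G \<longleftrightarrow> isomorphic G (digraph_complement G)"

definition num_iso_classes :: "'a pair_pre_digraph set \<Rightarrow> nat" where
  "num_iso_classes S = card (S // {(G, H). G \<in> S \<and> H \<in> S \<and> isomorphic G H})"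

definition C_u :: "nat \<Rightarrow> nat" where
  "C_u n = num_iso_classes {G. circulant n G \<and> symmetric (with_proj G)}"

definition C_sd :: "nat \<Rightarrow> nat" where
  "C_sd n = num_iso_classes {G. circulant n G \<and> self_complementary G}"

definition C_su :: "nat \<Rightarrow> nat" where
  "C_su n = num_iso_classes {G. circulant n G \<and> symmetric (with_proj G) \<and> self_complementary G}"

definition C_t :: "nat \<Rightarrow> nat" where
  "C_t n = num_iso_classes {G. circulant n G \<and> tournament G}"

lemma isomorphic_iff:
  assumes "pair_wf_digraph G"
  shows "isomorphic G H \<longleftrightarrow> (\<exists>f. bij_betw f (pverts G) (pverts H) \<and>
           parcs H = (\<lambda>(u, v). (f u, f v)) ` parcs G)"
proof
  assume "isomorphic G H"
  then obtain h where h: "pre_digraph.digraph_isomorphism (with_proj G) h"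
      and H: "with_proj H = app_iso h (with_proj G)"
    unfolding isomorphic_def digraph_iso_def by blast
  have "wf_digraph (with_proj G)" using assms by (simp add: wf_digraph_wp_iff)
  from wf_digraph.arcs_ends_app_iso_eq[OF this h]
  have "parcs H = (\<lambda>(u, v). (iso_verts h u, iso_verts h v)) ` parcs G"
    by (simp flip: H)
  moreover have "pverts H = iso_verts h ` pverts G"
    using arg_cong[OF H, of verts] by simp
  ultimately show "\<exists>f. bij_betw f (pverts G) (pverts H) \<and>
           parcs H = (\<lambda>(u, v). (f u, f v)) ` parcs G"
    using h by (auto simp: pre_digraph.digraph_isomorphism_def bij_betw_def)
next
  assume "\<exists>f. bij_betw f (pverts G) (pverts H) \<and> parcs H = (\<lambda>(u, v). (f u, f v)) ` parcs G"
  then obtain f where f: "inj_on f (pverts G)" "f ` pverts G = pverts H"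
      "parcs H = (\<lambda>(u, v). (f u, f v)) ` parcs G"
    by (auto simp: bij_betw_def)
  let ?h = "\<lparr>iso_verts = f, iso_arcs = (\<lambda>(u, v). (f u, f v)), iso_head = snd, iso_tail = fst\<rparr>"
  have "inj_on (\<lambda>(u, v). (f u, f v)) (parcs G)"
    using f(1) pair_wf_digraph.in_arcsD1[OF assms] pair_wf_digraph.in_arcsD2[OF assms]
    by (auto simp: inj_on_def)
  then have "pre_digraph.digraph_isomorphism (with_proj G) ?h"
    using assms f(1) by (auto simp: pre_digraph.digraph_isomorphism_def wf_digraph_wp_iff)
  moreover have "with_proj H = app_iso ?h (with_proj G)"
    using f by (simp add: with_proj_def app_iso_def)
  ultimately show "isomorphic G H"
    unfolding isomorphic_def digraph_iso_def by blast
qed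

text \<open>
  The enumerators are meaningful: isomorphism is an equivalence relation on each of the sets of
  circulants considered, and there are only finitely many circulants of a given order.
\<close>

lemma equiv_isomorphic:
  assumes "\<And>G. G \<in> S \<Longrightarrow> pair_wf_digraph G"
  shows "equiv S {(G, H). G \<in> S \<and> H \<in> S \<and> isomorphic G H}"
proof (rule equivI)
  have wf: "wf_digraph (with_proj G)" if "G \<in> S" for G
    using assms[OF that] by (simp add: wf_digraph_wp_iff)
  show "{(G, H). G \<in> S \<and> H \<in> S \<and> isomorphic G H} \<subseteq> S \<times> S" by auto
  show "refl_on S {(G, H). G \<in> S \<and> H \<in> S \<and> isomorphic G H}"
    using assms by (auto simp: refl_on_def isomorphic_iff intro!: exI[where x = id])
  show "sym {(G, H). G \<in> S \<and> H \<in> S \<and> isomorphic G H}"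
    by (auto simp: sym_def isomorphic_def intro: digraph_iso_swap[OF wf])
  show "trans {(G, H). G \<in> S \<and> H \<in> S \<and> isomorphic G H}"
    by (auto simp: trans_def isomorphic_def intro: digraph_iso_trans)
qed

lemma finite_circulants: "finite {G. circulant n G}"
proof (rule finite_subset)
  show "{G. circulant n G} \<subseteq> (\<lambda>A. \<lparr>pverts = {..<n}, parcs = A\<rparr>) ` Pow ({..<n} \<times> {..<n})"
  proof
    fix G assume "G \<in> {G. circulant n G}"
    then have "pair_wf_digraph G" "pverts G = {..<n}"
      by (auto simp: circulant_def pair_digraph_def pair_fin_digraph_def)
    then show "G \<in> (\<lambda>A. \<lparr>pverts = {..<n}, parcs = A\<rparr>) ` Pow ({..<n} \<times> {..<n})"
      by (intro image_eqI[where x = "parcs G"])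
         (auto dest: pair_wf_digraph.in_arcsD1 pair_wf_digraph.in_arcsD2)
  qed
qed simp

end

theory Submission
  imports Defs "HOL-Number_Theory.Pocklington" "HOL-Combinatorics.Permutations"
begin

text \<open>
  A circulant of prime order \<open>p\<close> is a Cayley digraph of the residues modulo \<open>p\<close>, determined by its
  connection set \<open>S\<close> of nonzero residues. The proof turns the four enumerators into counts of orbits
  of the multiplicative group \<open>U\<close> of order \<open>p - 1\<close> on such sets, and then compares fixed points.

  Isomorphic circulants of prime order have connection sets that differ by a dilation
  \<open>S \<mapsto> a S\<close> (\<open>isomorphic_cay_iff\<close>). Let \<open>X\<close> be the set of isomorphisms between them, on which pairs
  of rotations act by composition on both sides. The cardinality of \<open>X\<close> divides \<open>p!\<close>, hence is not
  divisible by \<open>p\<^sup>2\<close>, so not all orbits of this action have \<open>p\<^sup>2\<close> elements. An isomorphism in a smaller orbit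
  intertwines two nontrivial rotations, and is therefore affine (\<open>affine_iso_exists\<close>).

  Complementing the digraph complements \<open>S\<close>, symmetry of the digraph says \<open>- S = S\<close>, and being a
  tournament says that \<open>- S\<close> is the complement of \<open>S\<close>. Counting orbits of \<open>U\<close> through stabilizers
  (\<open>num_iso_classes_cay\<close>), and noting that for a self-complementary set as many \<open>a\<close> map \<open>S\<close> to its
  complement as map \<open>S\<close> to itself, multiplies each enumerator by \<open>p - 1\<close> and makes it the number of
  pairs \<open>(a, S)\<close> such that

    \<^item> \<open>a S\<close> is the complement of \<open>S\<close>, for the self-complementary circulants;
    \<^item> \<open>- S = S\<close> and \<open>a S = S\<close>, for the undirected circulants;
    \<^item> \<open>- S = S\<close> and \<open>a S\<close> is the complement of \<open>S\<close>, for the self-complementary undirected ones.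

  If \<open>a\<close> has even order, some set is mapped by \<open>a\<close> to its complement, and the symmetric difference with
  that set shows that as many sets are complemented as are fixed by \<open>a\<close>
  (\<open>card_complemented_by_eq_card_fixed_by\<close>). If \<open>4\<close> divides the order of \<open>a\<close>, then \<open>-1\<close> is an even
  power of \<open>a\<close>, so \<open>- S = S\<close> holds automatically and \<open>a\<close> contributes equally to all three counts. If
  the order is twice an odd number, then \<open>-1\<close> is an odd power of \<open>a\<close>, and \<open>a\<close> contributes equally to
  the first two counts and nothing to the third. If the order is odd, \<open>a\<close> contributes only to the
  second count, and by the same amount as \<open>- a\<close>, whose order is twice an odd number. Adding up gives
  the identity (\<open>sum_complemented_by_fixed_by\<close>).

  If \<open>p\<close> is \<open>3\<close> modulo \<open>4\<close>, then \<open>4\<close> does not divide \<open>p - 1\<close>. So whenever \<open>a S\<close> is the complement of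
  \<open>S\<close>, the residue \<open>-1\<close> is an odd power of \<open>a\<close> and \<open>- S\<close> is the complement too: the self-complementary
  circulants are the tournaments, and none of them is undirected.
\<close>

section \<open>Generalities on finite sets and maps\<close>

lemma sum_card_swap:
  assumes "finite A" and "finite B"
  shows "(\<Sum>x\<in>A. card {y \<in> B. P x y}) = (\<Sum>y\<in>B. card {x \<in> A. P x y})"
proof -
  have "(\<Sum>x\<in>A. card {y \<in> B. P x y}) = (\<Sum>x\<in>A. \<Sum>y\<in>B. if P x y then 1 else 0)"
    using assms by (simp add: sum.If_cases Int_def)
  also have "\<dots> = (\<Sum>y\<in>B. \<Sum>x\<in>A. if P x y then 1 else 0)"
    by (rule sum.swap)
  also have "\<dots> = (\<Sum>y\<in>B. card {x \<in> A. P x y})"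
    using assms by (simp add: sum.If_cases Int_def)
  finally show ?thesis .
qed

text \<open>
  Colour each element by the parity of its distance along \<open>f\<close> from a representative of its component,
  where two elements share a component if their forward trajectories meet. The parity is well defined
  since no trajectory returns to itself after an odd number of steps.
\<close>
lemma alternating_set_exists:
  assumes maps: "f ` X \<subseteq> X"
    and even: "\<And>x i j. x \<in> X \<Longrightarrow> (f ^^ i) x = (f ^^ j) x \<Longrightarrow> even (i + j)"
  obtains B where "B \<subseteq> X" and "\<And>x. x \<in> X \<Longrightarrow> f x \<in> B \<longleftrightarrow> x \<notin> B"
proof -
  define R where "R x = {y \<in> X. \<exists>i j. (f ^^ i) x = (f ^^ j) y}" for x
  define r where "r x = (SOME y. y \<in> R x)" for x
  have r: "r x \<in> R x" if "x \<in> X" for x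
    unfolding r_def using that by (intro someI[of "\<lambda>y. y \<in> R x" x]) (auto simp: R_def intro!: exI[of _ 0])
  have "R (f x) = R x" for x
  proof -
    have "(\<exists>i j. (f ^^ i) (f x) = (f ^^ j) y) \<longleftrightarrow> (\<exists>i j. (f ^^ i) x = (f ^^ j) y)" for y
    proof safe
      fix i j assume "(f ^^ i) (f x) = (f ^^ j) y"
      then have "(f ^^ Suc i) x = (f ^^ j) y" by (simp only: funpow_Suc_right o_apply)
      then show "\<exists>i j. (f ^^ i) x = (f ^^ j) y" by blast
    next
      fix i j assume "(f ^^ i) x = (f ^^ j) y"
      then have "(f ^^ i) (f x) = (f ^^ Suc j) y" by (simp add: funpow_swap1[symmetric])
      then show "\<exists>i j. (f ^^ i) (f x) = (f ^^ j) y" by blast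
    qed
    then show ?thesis by (simp add: R_def)
  qed
  then have r_step: "r (f x) = r x" for x by (simp add: r_def)
  define B where "B = {x \<in> X. \<exists>i j. (f ^^ i) x = (f ^^ j) (r x) \<and> even (i + j)}"
  have parity: "even (i + j) \<longleftrightarrow> x \<in> B" if x: "x \<in> X" and e: "(f ^^ i) x = (f ^^ j) (r x)" for x i j
  proof
    show "x \<in> B" if "even (i + j)" using that x e unfolding B_def by blast
    assume "x \<in> B"
    then obtain k l where kl: "(f ^^ k) x = (f ^^ l) (r x)" "even (k + l)" by (auto simp: B_def)
    have "(f ^^ (k + j)) (r x) = (f ^^ (k + i)) x" by (simp add: funpow_add e)
    also have "\<dots> = (f ^^ (i + k)) x" by (simp add: add.commute)
    also have "\<dots> = (f ^^ (i + l)) (r x)" by (simp add: funpow_add kl)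
    finally have "(f ^^ (k + j)) (r x) = (f ^^ (i + l)) (r x)" .
    moreover have "r x \<in> X" using r[OF x] by (simp add: R_def)
    ultimately have "even (k + j + (i + l))" by (rule even[rotated])
    with kl(2) show "even (i + j)" by presburger
  qed
  have "f x \<in> B \<longleftrightarrow> x \<notin> B" if x: "x \<in> X" for x
  proof -
    obtain i j where e: "(f ^^ i) x = (f ^^ j) (r x)" using r[OF x] by (auto simp: R_def)
    then have "(f ^^ i) (f x) = (f ^^ Suc j) (r (f x))"
      by (simp add: funpow_swap1[symmetric] r_step)
    from parity[OF _ this] parity[OF x e] x maps show ?thesis by auto
  qed
  moreover have "B \<subseteq> X" by (auto simp: B_def)
  ultimately show ?thesis using that by blast
qed

section \<open>Isomorphisms between two relations\<close>

definition isos :: "'a rel \<Rightarrow> 'a rel \<Rightarrow> 'a set \<Rightarrow> ('a \<Rightarrow> 'a) set" where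
  "isos A B V = {f. f permutes V \<and> map_prod f f ` A = B}"

lemma map_prod_comp_image: "map_prod (f \<circ> g) (f \<circ> g) ` A = map_prod f f ` map_prod g g ` A"
  by (simp add: image_comp map_prod_compose)

lemma isos_comp: "f \<in> isos A B V \<Longrightarrow> g \<in> isos B C V \<Longrightarrow> g \<circ> f \<in> isos A C V"
  unfolding isos_def by (auto simp only: mem_Collect_eq permutes_compose map_prod_comp_image)

lemma isos_inv: "f \<in> isos A B V \<Longrightarrow> inv_into UNIV f \<in> isos B A V"
proof -
  assume "f \<in> isos A B V"
  then have f: "f permutes V" "map_prod f f ` A = B" by (auto simp: isos_def)
  have "map_prod (inv_into UNIV f) (inv_into UNIV f) ` B =
      map_prod (inv_into UNIV f \<circ> f) (inv_into UNIV f \<circ> f) ` A"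
    unfolding map_prod_comp_image f(2) ..
  also have "\<dots> = A" by (simp add: permutes_inv_o[OF f(1)] map_prod.id)
  finally show ?thesis using permutes_inv[OF f(1)] by (simp add: isos_def)
qed

text \<open>
  The fibres of the map that sends a permutation to the image of \<open>A\<close> partition all permutations of
  \<open>V\<close>, and composing with a permutation that carries one image to another is a bijection between two
  fibres. This is Lagrange's theorem for the automorphism group, stated for a coset of it.
\<close>
lemma card_isos_dvd_fact:
  assumes V: "finite V" and g: "g \<in> isos A B V"
  shows "card (isos A B V) dvd fact (card V)"
proof -
  let ?P = "{f. f permutes V}"
  let ?C = "(\<lambda>h. isos A (map_prod h h ` A) V) ` ?P"
  have U: "\<Union>?C = ?P" by (auto simp: isos_def)
  have "card (isos A B V) dvd card (\<Union>?C)"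
  proof (rule dvd_partition)
    show "finite (\<Union>?C)" unfolding U using V by (rule finite_permutations)
    show "\<forall>c1\<in>?C. \<forall>c2\<in>?C. c1 \<noteq> c2 \<longrightarrow> c1 \<inter> c2 = {}"
    proof (intro ballI impI)
      fix c1 c2 assume "c1 \<in> ?C" "c2 \<in> ?C" and neq: "c1 \<noteq> c2"
      then obtain B1 B2 where "c1 = isos A B1 V" "c2 = isos A B2 V" by blast
      with neq show "c1 \<inter> c2 = {}" by (auto simp: isos_def)
    qed
    show "\<forall>c\<in>?C. card (isos A B V) dvd card c"
    proof safe
      fix h assume "h permutes V"
      then have "h \<in> isos A (map_prod h h ` A) V" by (simp add: isos_def)
      with isos_inv[OF g] have "h \<circ> inv_into UNIV g \<in> isos B (map_prod h h ` A) V" (is "_ \<in> isos B ?B V")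
        by (rule isos_comp)
      then obtain k where k: "k \<in> isos B ?B V" by blast
      then have kV: "k permutes V" by (simp add: isos_def)
      have "bij_betw (\<lambda>f. k \<circ> f) (isos A B V) (isos A ?B V)"
        by (rule bij_betw_byWitness[where f' = "\<lambda>f. inv_into UNIV k \<circ> f"])
           (use isos_comp[OF _ k] isos_comp[OF _ isos_inv[OF k]] in
             \<open>auto simp only: comp_assoc[symmetric] permutes_inv_o[OF kV] id_comp\<close>)
      then show "card (isos A B V) dvd card (isos A ?B V)" by (simp add: bij_betw_same_card)
    qed
  qed
  then show ?thesis unfolding U card_permutations[OF refl V] .
qed

section \<open>Dilations of sets of nonzero residues\<close>

locale odd_prime =
  fixes p :: nat
  assumes prime_p: "prime p" and odd_p: "odd p"
begin

abbreviation U :: "nat set" where "U \<equiv> {1..<p}"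

definition dilate :: "nat \<Rightarrow> nat set \<Rightarrow> nat set" where
  "dilate a S = (\<lambda>s. a * s mod p) ` S"

lemma p_gt_2: "p > 2"
  using prime_p odd_p prime_ge_2_nat[of p] by (cases "p = 2") auto

lemma coprime_U: "a \<in> U \<Longrightarrow> coprime a p"
  using prime_imp_coprime[OF prime_p, of a] nat_dvd_not_less[of a p] by (auto simp: coprime_commute)

lemma mod_in_U_iff: "a mod p \<in> U \<longleftrightarrow> coprime a p"
  using p_gt_2 prime_p
  by (metis atLeastLessThan_iff coprime_U coprime_commute coprime_mod_left_iff dvd_eq_mod_eq_0
      coprime_absorb_left less_one linorder_not_less mod_less_divisor not_prime_unit gr0I not_less_zero)

lemma mult_in_U: "coprime a p \<Longrightarrow> s \<in> U \<Longrightarrow> a * s mod p \<in> U"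
  using coprime_U by (simp only: mod_in_U_iff coprime_mult_left_iff)

lemma inj_on_mult:
  assumes "coprime a p"
  shows "inj_on (\<lambda>s. a * s mod p) {..<p}"
proof (rule inj_onI)
  fix s t assume st: "s \<in> {..<p}" "t \<in> {..<p}" and "a * s mod p = a * t mod p"
  then have "[s = t] (mod p)"
    using assms by (metis cong_def cong_mult_lcancel_nat)
  then show "s = t" using st by (simp add: cong_less_modulus_unique_nat)
qed

lemma bij_betw_mult: "coprime a p \<Longrightarrow> bij_betw (\<lambda>s. a * s mod p) U U"
  unfolding bij_betw_def
  by (intro conjI endo_inj_surj inj_on_subset[OF inj_on_mult]) (auto dest: mult_in_U[of a])

lemma inverse_U:
  assumes "coprime a p"
  obtains b where "b \<in> U" "[a * b = 1] (mod p)"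
proof -
  have "1 \<in> (\<lambda>s. a * s mod p) ` U"
    using bij_betw_mult[OF assms] p_gt_2 by (simp add: bij_betw_def)
  then show ?thesis using that p_gt_2 by (auto simp: cong_def)
qed

lemma dilate_subset: "coprime a p \<Longrightarrow> S \<subseteq> U \<Longrightarrow> dilate a S \<subseteq> U"
  unfolding dilate_def using mult_in_U by blast

lemma dilate_mult: "dilate (a * b) S = dilate a (dilate b S)"
  by (simp add: dilate_def image_image mod_simps mult.assoc)

lemma dilate_cong: "[a = b] (mod p) \<Longrightarrow> dilate a S = dilate b S"
  unfolding dilate_def cong_def by (intro image_cong refl) (metis mod_mult_left_eq)

lemma dilate_mod [simp]: "dilate (a mod p) S = dilate a S"
  by (rule dilate_cong) (simp add: cong_def)

lemma dilate_1: "S \<subseteq> U \<Longrightarrow> dilate 1 S = S"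
  unfolding dilate_def by (force simp: image_iff)

lemma dilate_compl: "coprime a p \<Longrightarrow> S \<subseteq> U \<Longrightarrow> dilate a (U - S) = U - dilate a S"
  unfolding dilate_def using bij_betw_mult[of a]
  by (metis bij_betw_def inj_on_image_set_diff subset_refl Diff_subset)

lemma dilate_eq_iff: "coprime a p \<Longrightarrow> S \<subseteq> U \<Longrightarrow> T \<subseteq> U \<Longrightarrow> dilate a S = dilate a T \<longleftrightarrow> S = T"
  unfolding dilate_def using bij_betw_mult[of a] by (metis bij_betw_def inj_on_image_eq_iff)

lemma dilate_commute: "dilate a (dilate b S) = dilate b (dilate a S)"
  by (metis dilate_mult mult.commute)

lemma mult_mem_dilate_iff:
  "coprime a p \<Longrightarrow> S \<subseteq> U \<Longrightarrow> x \<in> U \<Longrightarrow> a * x mod p \<in> dilate a S \<longleftrightarrow> x \<in> S"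
  unfolding dilate_def using bij_betw_mult[of a] by (metis bij_betw_def inj_on_image_mem_iff)

lemma dilate_power_fix: "dilate a S = S \<Longrightarrow> S \<subseteq> U \<Longrightarrow> dilate (a ^ k) S = S"
  by (induction k) (use dilate_1 in \<open>auto simp: dilate_mult\<close>)

lemma dilate_power_compl:
  assumes "dilate a S = U - S" "S \<subseteq> U" "coprime a p"
  shows "dilate (a ^ k) S = (if even k then S else U - S)"
proof (induction k)
  case (Suc k)
  have "dilate a (U - S) = U - (U - S)" unfolding dilate_compl[OF assms(3,2)] assms(1) ..
  then have "dilate a (U - S) = S" using assms(2) by blast
  with Suc show ?case using assms(1) by (simp add: dilate_mult)
qed (use dilate_1 assms in auto)

lemma compl_neq: "S \<subseteq> U \<Longrightarrow> U - S \<noteq> S"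
  using p_gt_2 by force

text \<open>
  The residue \<open>-1\<close> modulo \<open>p\<close>, as a natural number below \<open>p\<close>.
\<close>
definition minus_one :: nat where "minus_one = p - 1"

lemma neg_in_U: "minus_one \<in> U" using p_gt_2 by (auto simp: minus_one_def)

lemma coprime_neg: "coprime minus_one p" using neg_in_U coprime_U by blast

lemma neg_int: "[int minus_one = -1] (mod int p)"
  using p_gt_2 by (auto simp: minus_one_def cong_iff_dvd_diff of_nat_diff)

lemma cong_neg_iff: "[a = minus_one] (mod p) \<longleftrightarrow> [int a = -1] (mod int p)"
  by (metis cong_int_iff cong_sym cong_trans neg_int)

lemma neg_power_odd: "odd k \<Longrightarrow> [minus_one ^ k = minus_one] (mod p)"
  unfolding cong_neg_iff using cong_pow[OF neg_int, of k] by simp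

lemma neg_neg: "[minus_one * minus_one = 1] (mod p)"
  using cong_mult[OF neg_int neg_int] by (simp flip: cong_int_iff)

lemma neg_neq_1: "\<not> [minus_one = 1] (mod p)"
  using p_gt_2 by (simp add: minus_one_def cong_def)

lemma dilate_neg_neg: "S \<subseteq> U \<Longrightarrow> dilate minus_one (dilate minus_one S) = S"
  using dilate_cong[OF neg_neg, of S] dilate_1[of S] by (simp add: dilate_mult)

section \<open>Comparing fixed and complemented sets\<close>

text \<open>
  An odd exponent that need not be the order is easier to provide than the order itself: the same
  exponent then shows that multiplication by \<open>-1\<close> exchanges this set with the next one, whose members
  are the residues of order twice an odd number.
\<close>
definition odd_order :: "nat set" where
  "odd_order = {a \<in> U. \<exists>k. odd k \<and> [a ^ k = 1] (mod p)}"

definition neg_odd_power :: "nat set" where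
  "neg_odd_power = {a \<in> U. \<exists>k. odd k \<and> [a ^ k = minus_one] (mod p)}"

lemma mult_neg_odd_order: "a \<in> odd_order \<Longrightarrow> minus_one * a mod p \<in> neg_odd_power"
  unfolding odd_order_def neg_odd_power_def 
proof (clarify, intro conjI)
  fix k assume a: "a \<in> U" and k: "odd k" "[a ^ k = 1] (mod p)"
  show "minus_one * a mod p \<in> U" using mult_in_U[OF coprime_neg a] .
  have "[(minus_one * a) ^ k = minus_one * 1] (mod p)"
    unfolding power_mult_distrib by (intro cong_mult neg_power_odd k)
  then have "[(minus_one * a mod p) ^ k = minus_one] (mod p)" by (simp add: cong_def power_mod)
  with k show "\<exists>k. odd k \<and> [(minus_one * a mod p) ^ k = minus_one] (mod p)" by blast
qed

lemma mult_neg_neg_odd_power: "a \<in> neg_odd_power \<Longrightarrow> minus_one * a mod p \<in> odd_order"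
  unfolding odd_order_def neg_odd_power_def 
proof (clarify, intro conjI)
  fix k assume a: "a \<in> U" and k: "odd k" "[a ^ k = minus_one] (mod p)"
  show "minus_one * a mod p \<in> U" using mult_in_U[OF coprime_neg a] .
  have "[(minus_one * a) ^ k = minus_one * minus_one] (mod p)"
    unfolding power_mult_distrib by (intro cong_mult neg_power_odd k)
  with neg_neg have "[(minus_one * a) ^ k = 1] (mod p)" by (metis cong_trans)
  then have "[(minus_one * a mod p) ^ k = 1] (mod p)" by (simp add: cong_def power_mod)
  with k show "\<exists>k. odd k \<and> [(minus_one * a mod p) ^ k = 1] (mod p)" by blast
qed

lemma mult_neg_twice: "a \<in> U \<Longrightarrow> minus_one * (minus_one * a mod p) mod p = a"
  using cong_mult[OF neg_neg cong_refl[of a]] by (simp add: cong_def mod_simps mult.assoc)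

lemma odd_order_neg_odd_power_disjoint: "odd_order \<inter> neg_odd_power = {}"
proof -
  have False if "[a ^ k = 1] (mod p)" "odd l" "[a ^ l = minus_one] (mod p)" "odd k" for a k l
  proof -
    have "[(a ^ k) ^ l = 1 ^ l] (mod p)" by (intro cong_pow that)
    moreover have "[(a ^ l) ^ k = minus_one ^ k] (mod p)" by (intro cong_pow that)
    ultimately have "[minus_one ^ k = 1] (mod p)"
      by (metis cong_sym cong_trans power_commutes power_mult mult.commute power_one)
    with neg_power_odd[OF \<open>odd k\<close>] neg_neq_1 show False by (metis cong_sym cong_trans)
  qed
  then show ?thesis unfolding odd_order_def neg_odd_power_def by blast
qed

lemma even_order:
  assumes "a \<in> U - odd_order"
  shows "even (ord p a)"
  using assms ord[of a p] unfolding odd_order_def by blast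

text \<open>
  The half power is a square root of \<open>1\<close> other than \<open>1\<close>, and a field has only one of these.
\<close>
lemma half_order:
  assumes "a \<in> U" "even (ord p a)"
  shows "[a ^ (ord p a div 2) = minus_one] (mod p)"
proof -
  let ?b = "a ^ (ord p a div 2)"
  have "coprime p a" using coprime_U assms(1) by (simp add: coprime_commute)
  then have o: "0 < ord p a" by simp
  then have "\<not> [?b = 1] (mod p)" using assms(2) o by (intro ord_minimal) (auto elim!: evenE simp del: ord_gt_0_iff)
  then have n: "\<not> [int ?b = 1] (mod int p)" by (metis cong_int_iff of_nat_1)
  have "?b ^ 2 = a ^ ord p a" using assms(2) by (simp flip: power_mult)
  then have "[int (?b ^ 2) = 1] (mod int p)"
    using ord[of a p] by (metis cong_int_iff of_nat_1)
  then have "int p dvd (int ?b - 1) * (int ?b + 1)"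
    by (simp add: cong_iff_dvd_diff power2_eq_square algebra_simps)
  then have "int p dvd int ?b - 1 \<or> int p dvd int ?b + 1"
    using prime_p by (simp add: prime_dvd_mult_iff)
  with n show ?thesis unfolding cong_neg_iff by (simp add: cong_iff_dvd_diff)
qed

definition fixed_by :: "nat \<Rightarrow> nat set set" where
  "fixed_by a = {S \<in> Pow U. dilate a S = S}"

definition complemented_by :: "nat \<Rightarrow> nat set set" where
  "complemented_by a = {S \<in> Pow U. dilate a S = U - S}"

lemma finite_fixed_by: "finite (fixed_by a)"
  by (auto simp: fixed_by_def)

text \<open>
  Colour each cycle of multiplication by \<open>a\<close> alternately. This is possible because every such cycle has
  the order of \<open>a\<close> as its length.
\<close>
lemma complemented_by_exists:
  assumes a: "a \<in> U" and e: "even (ord p a)"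
  obtains S where "S \<in> complemented_by a"
proof -
  let ?f = "\<lambda>x. a * x mod p"
  have cop: "coprime a p" using a by (rule coprime_U)
  have pow: "(?f ^^ i) x = a ^ i * x mod p" if "x \<in> U" for i x
    using that by (induction i) (auto simp: mod_simps mult.assoc)
  obtain B where B: "B \<subseteq> U" "\<And>x. x \<in> U \<Longrightarrow> ?f x \<in> B \<longleftrightarrow> x \<notin> B"
  proof (rule alternating_set_exists[of ?f U])
    show "?f ` U \<subseteq> U" using mult_in_U[OF cop] by blast
    fix x i j assume x: "x \<in> U" and "(?f ^^ i) x = (?f ^^ j) x"
    then have "[a ^ i * x = a ^ j * x] (mod p)" by (simp add: pow cong_def)
    then have "[a ^ i = a ^ j] (mod p)"
      using coprime_U[OF x] by (simp add: cong_mult_rcancel_nat)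
    then have "[i = j] (mod ord p a)"
      using cop by (simp add: order_divides_expdiff coprime_commute)
    then have "[i = j] (mod 2)" using e by (rule cong_dvd_modulus_nat)
    then show "even (i + j)" unfolding cong_def by presburger
  qed (rule that)
  have iff: "x \<in> dilate a B \<longleftrightarrow> x \<notin> B" if "x \<in> U" for x
  proof -
    have "x \<in> ?f ` U" using that bij_betw_mult[OF cop] by (simp add: bij_betw_def)
    then obtain y where "y \<in> U" "x = ?f y" by blast
    then show ?thesis using B(2)[of y] mult_mem_dilate_iff[OF cop B(1), of y] by simp
  qed
  have "dilate a B = U - B"
  proof (intro subset_antisym subsetI)
    fix x assume x: "x \<in> dilate a B"
    then have "x \<in> U" using dilate_subset[OF cop B(1)] by (rule rev_subsetD)
    with x iff[OF this] show "x \<in> U - B" by simp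
  next
    fix x assume "x \<in> U - B"
    then show "x \<in> dilate a B" using iff[of x] by simp
  qed
  with B(1) have "B \<in> complemented_by a" by (simp add: complemented_by_def)
  then show ?thesis by (rule that)
qed

text \<open>
  Indicator functions modulo \<open>2\<close> explain this: the complemented sets are the solutions of an
  inhomogeneous linear equation, the fixed sets those of the homogeneous one. A particular solution \<open>B\<close>
  exists, and adding it, which is taking the symmetric difference with \<open>B\<close>, is the bijection.
\<close>
lemma card_complemented_by_eq_card_fixed_by:
  assumes a: "a \<in> U" and e: "even (ord p a)"
  shows "card (complemented_by a) = card (fixed_by a)"
proof -
  obtain B where "B \<in> complemented_by a" using complemented_by_exists[OF assms] .
  then have B: "B \<subseteq> U" "dilate a B = U - B" by (auto simp: complemented_by_def)
  have cop: "coprime a p" using a by (rule coprime_U)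
  \<comment> \<open>\<open>D\<close> is the symmetric difference with \<open>B\<close>.\<close>
  define D where "D S = (S - B) \<union> (B - S)" for S
  have inj: "inj_on (\<lambda>s. a * s mod p) U" using bij_betw_mult[OF cop] by (simp add: bij_betw_def)
  have dilate_D: "dilate a (D S) = (dilate a S - dilate a B) \<union> (dilate a B - dilate a S)" if "S \<subseteq> U" for S
    unfolding D_def dilate_def image_Un using that B(1)
    by (intro arg_cong2[where f = "(\<union>)"] inj_on_image_set_diff[OF inj]) auto
  have "bij_betw D (complemented_by a) (fixed_by a)"
  proof (rule bij_betw_byWitness[where f' = D])
    show "\<forall>S\<in>complemented_by a. D (D S) = S" "\<forall>S\<in>fixed_by a. D (D S) = S" by (auto simp: D_def)
    show "D ` complemented_by a \<subseteq> fixed_by a"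
    proof (rule image_subsetI)
      fix S assume "S \<in> complemented_by a"
      then have S: "S \<subseteq> U" "dilate a S = U - S" by (auto simp: complemented_by_def)
      show "D S \<in> fixed_by a" using S B dilate_D[OF S(1)] unfolding fixed_by_def by (auto simp: D_def)
    qed
    show "D ` fixed_by a \<subseteq> complemented_by a"
    proof (rule image_subsetI)
      fix S assume "S \<in> fixed_by a"
      then have S: "S \<subseteq> U" "dilate a S = S" by (auto simp: fixed_by_def)
      show "D S \<in> complemented_by a" using S B dilate_D[OF S(1)] unfolding complemented_by_def
        by (auto simp: D_def)
    qed
  qed
  then show ?thesis by (rule bij_betw_same_card)
qed

text \<open>
  On sets fixed by \<open>-1\<close> the residues \<open>a\<close> and \<open>- a\<close> act alike.
\<close>
lemma card_fixed_by_neg_mult: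
  "card (fixed_by minus_one \<inter> fixed_by (minus_one * a mod p)) = card (fixed_by minus_one \<inter> fixed_by a)"
proof -
  have "fixed_by minus_one \<inter> fixed_by (minus_one * a mod p) = fixed_by minus_one \<inter> fixed_by a"
    by (auto simp: fixed_by_def dilate_mult dilate_commute[of minus_one])
  then show ?thesis by simp
qed

text \<open>
  Applying \<open>a\<close> an odd number of times to a complemented set still complements it, but some odd power
  of \<open>a\<close> is the identity.
\<close>
lemma complemented_by_odd_order: "a \<in> odd_order \<Longrightarrow> complemented_by a = {}"
proof (rule equals0I)
  fix S assume "a \<in> odd_order" "S \<in> complemented_by a"
  then obtain k where a: "a \<in> U" and k: "odd k" "[a ^ k = 1] (mod p)"
    and S: "S \<subseteq> U" "dilate a S = U - S"
    by (auto simp: odd_order_def complemented_by_def)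
  have "S = U - S"
    using dilate_power_compl[OF S(2,1) coprime_U[OF a], of k] dilate_cong[OF k(2), of S]
      dilate_1[OF S(1)] k(1) by simp
  with compl_neq[OF S(1)] show False by simp
qed

lemma fixed_by_neg_odd_power: "a \<in> neg_odd_power \<Longrightarrow> fixed_by a \<subseteq> fixed_by minus_one"
proof
  fix S assume "a \<in> neg_odd_power" "S \<in> fixed_by a"
  then obtain k where k: "[a ^ k = minus_one] (mod p)" and S: "S \<subseteq> U" "dilate a S = S"
    by (auto simp: neg_odd_power_def fixed_by_def)
  then show "S \<in> fixed_by minus_one"
    using dilate_power_fix[OF S(2,1), of k] dilate_cong[OF k(1), of S] by (auto simp: fixed_by_def)
qed

lemma complemented_by_neg_odd_power: "a \<in> neg_odd_power \<Longrightarrow> complemented_by a \<subseteq> complemented_by minus_one"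
proof
  fix S assume "a \<in> neg_odd_power" "S \<in> complemented_by a"
  then obtain k where a: "a \<in> U" and k: "odd k" "[a ^ k = minus_one] (mod p)"
    and S: "S \<subseteq> U" "dilate a S = U - S"
    by (auto simp: neg_odd_power_def complemented_by_def)
  then show "S \<in> complemented_by minus_one"
    using dilate_power_compl[OF S(2,1) coprime_U[OF a], of k] dilate_cong[OF k(2), of S]
    by (auto simp: complemented_by_def)
qed

lemma fixed_by_complemented_by_disjoint: "fixed_by a \<inter> complemented_by a = {}"
proof (rule equals0I)
  fix S assume "S \<in> fixed_by a \<inter> complemented_by a"
  then have "S \<subseteq> U" and "dilate a S = S" and "dilate a S = U - S"
    unfolding fixed_by_def complemented_by_def by blast+
  then have "S \<subseteq> U" and "U - S = S" by (blast, metis)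
  then show False using compl_neq by blast
qed

text \<open>
  Here the order is divisible by \<open>4\<close>, so \<open>-1\<close> is an even power of \<open>a\<close>, and even powers fix both the
  fixed and the complemented sets.
\<close>
lemma neither_odd_order_nor_neg_odd_power:
  assumes "a \<in> U - odd_order - neg_odd_power"
  shows "fixed_by a \<subseteq> fixed_by minus_one" and "complemented_by a \<subseteq> fixed_by minus_one"
proof -
  let ?k = "ord p a div 2"
  have a: "a \<in> U" using assms by simp
  have pow: "[a ^ ?k = minus_one] (mod p)"
    using assms by (intro half_order even_order) auto
  then have ev: "even ?k" using assms unfolding neg_odd_power_def by blast
  show "fixed_by a \<subseteq> fixed_by minus_one"
  proof
    fix S assume "S \<in> fixed_by a"
    then have S: "S \<subseteq> U" "dilate a S = S" by (auto simp: fixed_by_def)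
    show "S \<in> fixed_by minus_one"
      using dilate_power_fix[OF S(2,1), of ?k] dilate_cong[OF pow, of S] S(1) by (simp add: fixed_by_def)
  qed
  show "complemented_by a \<subseteq> fixed_by minus_one"
  proof
    fix S assume "S \<in> complemented_by a"
    then have S: "S \<subseteq> U" "dilate a S = U - S" by (auto simp: complemented_by_def)
    show "S \<in> fixed_by minus_one"
      using dilate_power_compl[OF S(2,1) coprime_U[OF a], of ?k] dilate_cong[OF pow, of S] ev S(1)
      by (simp add: fixed_by_def)
  qed
qed

text \<open>
  The three parts of \<open>U\<close> are treated separately. Over residues of odd order only the first sum on the
  right is nonzero, and the substitution \<open>a \<mapsto> - a\<close> turns it into a second copy of the left sum over
  residues of order twice an odd number.
\<close>
lemma sum_complemented_by_fixed_by:
  "2 * (\<Sum>a\<in>U. card (complemented_by a)) =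
     (\<Sum>a\<in>U. card (fixed_by minus_one \<inter> fixed_by a)) + (\<Sum>a\<in>U. card (fixed_by minus_one \<inter> complemented_by a))"
proof -
  define R where "R = U - odd_order - neg_odd_power"
  have split: "(\<Sum>a\<in>U. f a) = (\<Sum>a\<in>odd_order. f a) + (\<Sum>a\<in>neg_odd_power. f a) + (\<Sum>a\<in>R. f a)" for f :: "nat \<Rightarrow> nat"
  proof -
    have "U = (odd_order \<union> neg_odd_power) \<union> R" by (auto simp: R_def odd_order_def neg_odd_power_def)
    moreover have "finite odd_order" "finite neg_odd_power" "finite R" by (auto simp: R_def odd_order_def neg_odd_power_def)
    moreover have "(odd_order \<union> neg_odd_power) \<inter> R = {}" by (auto simp: R_def)
    ultimately show ?thesis using odd_order_neg_odd_power_disjoint by (simp add: sum.union_disjoint)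
  qed
  have UO: "a \<in> U - odd_order" if "a \<in> neg_odd_power \<union> R" for a
    using that odd_order_neg_odd_power_disjoint by (auto simp: R_def neg_odd_power_def)
  have eq: "card (complemented_by a) = card (fixed_by a)" if "a \<in> neg_odd_power \<union> R" for a
    using UO[OF that] even_order card_complemented_by_eq_card_fixed_by by blast
  have O: "(\<Sum>a\<in>odd_order. card (fixed_by minus_one \<inter> fixed_by a)) =
      (\<Sum>a\<in>neg_odd_power. card (complemented_by a))"
  proof -
    have "(\<Sum>a\<in>odd_order. card (fixed_by minus_one \<inter> fixed_by a)) =
      (\<Sum>a\<in>neg_odd_power. card (fixed_by minus_one \<inter> fixed_by a))"
      by (rule sum.reindex_bij_witness[where i = "\<lambda>a. minus_one * a mod p" and j = "\<lambda>a. minus_one * a mod p"])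
         (auto simp only: mult_neg_odd_order mult_neg_neg_odd_power card_fixed_by_neg_mult,
          auto intro!: mult_neg_twice simp: odd_order_def neg_odd_power_def)
    also have "\<dots> = (\<Sum>a\<in>neg_odd_power. card (complemented_by a))"
      using fixed_by_neg_odd_power eq by (intro sum.cong refl) (auto simp: Int_absorb1)
    finally show ?thesis .
  qed
  have T: "(\<Sum>a\<in>neg_odd_power. card (fixed_by minus_one \<inter> fixed_by a)) = (\<Sum>a\<in>neg_odd_power. card (complemented_by a))"
    using fixed_by_neg_odd_power eq by (intro sum.cong refl) (auto simp: Int_absorb1)
  have T': "(\<Sum>a\<in>neg_odd_power. card (fixed_by minus_one \<inter> complemented_by a)) = 0"
  proof (intro sum.neutral ballI)
    fix a assume "a \<in> neg_odd_power"
    then have "fixed_by minus_one \<inter> complemented_by a = {}"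
      using complemented_by_neg_odd_power fixed_by_complemented_by_disjoint by blast
    then show "card (fixed_by minus_one \<inter> complemented_by a) = 0" by simp
  qed
  have R: "(\<Sum>a\<in>R. card (fixed_by minus_one \<inter> fixed_by a)) = (\<Sum>a\<in>R. card (complemented_by a))"
    using neither_odd_order_nor_neg_odd_power(1) eq by (intro sum.cong refl) (auto simp: Int_absorb1 R_def)
  have R': "(\<Sum>a\<in>R. card (fixed_by minus_one \<inter> complemented_by a)) = (\<Sum>a\<in>R. card (complemented_by a))"
    using neither_odd_order_nor_neg_odd_power(2) by (intro sum.cong refl) (auto simp: Int_absorb1 R_def)
  have O': "(\<Sum>a\<in>odd_order. card (complemented_by a)) = 0"
    "(\<Sum>a\<in>odd_order. card (fixed_by minus_one \<inter> complemented_by a)) = 0"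
    using complemented_by_odd_order by (auto intro!: sum.neutral)
  show ?thesis unfolding split O O' T T' R R' by presburger
qed

section \<open>Circulants of prime order as Cayley digraphs\<close>

text \<open>
  The difference \<open>v - u\<close> modulo \<open>p\<close>; the subtraction of naturals is exact for \<open>u \<le> p\<close>.
\<close>
definition step :: "nat \<Rightarrow> nat \<Rightarrow> nat" where "step u v = (v + (p - u)) mod p"

definition cay :: "nat set \<Rightarrow> nat pair_pre_digraph" where
  "cay S = \<lparr>pverts = {..<p}, parcs = {(u, v). u < p \<and> v < p \<and> step u v \<in> S}\<rparr>"

lemma step_less [simp]: "step u v < p"
  using p_gt_2 by (simp add: step_def)

lemma add_step: "u < p \<Longrightarrow> v < p \<Longrightarrow> (u + step u v) mod p = v"
  by (simp add: step_def mod_simps)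

lemma step_eqI:
  assumes "u < p" "s < p" "(u + s) mod p = v"
  shows "step u v = s"
proof -
  have "step u v = (u + s + (p - u)) mod p"
    unfolding step_def assms(3)[symmetric] by (rule mod_add_left_eq)
  also have "\<dots> = s" using assms by simp
  finally show ?thesis .
qed

lemma step_zero [simp]: "s < p \<Longrightarrow> step 0 s = s"
  by (rule step_eqI) auto

lemma step_eq_0_iff: "u < p \<Longrightarrow> v < p \<Longrightarrow> step u v = 0 \<longleftrightarrow> u = v"
  using add_step[of u v] by (auto intro: step_eqI)

lemma step_in_U_iff: "u < p \<Longrightarrow> v < p \<Longrightarrow> step u v \<in> U \<longleftrightarrow> u \<noteq> v"
  using step_eq_0_iff[of u v] step_less[of u v] by (auto simp del: step_less)

lemma step_affine:
  assumes "u < p" "v < p"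
  shows "step ((a * u + b) mod p) ((a * v + b) mod p) = a * step u v mod p"
proof (rule step_eqI)
  have "((a * u + b) mod p + a * step u v mod p) mod p = (a * (u + step u v) + b) mod p"
    by (simp add: mod_simps algebra_simps)
  also have "\<dots> = (a * ((u + step u v) mod p) + b) mod p"
    by (metis mod_add_left_eq mod_mult_right_eq)
  also have "\<dots> = (a * v + b) mod p" unfolding add_step[OF assms] ..
  finally show "((a * u + b) mod p + a * step u v mod p) mod p = (a * v + b) mod p" .
qed (use p_gt_2 in auto)

lemma step_swap:
  assumes "u < p" "v < p"
  shows "step v u = minus_one * step u v mod p"
proof (rule step_eqI)
  have "(v + minus_one * step u v mod p) mod p = ((u + step u v) mod p + minus_one * step u v) mod p"
    by (simp add: add_step[OF assms] mod_simps)
  also have "\<dots> = (u + (minus_one + 1) * step u v) mod p" by (simp add: mod_simps algebra_simps)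
  also have "minus_one + 1 = p" using p_gt_2 by (simp add: minus_one_def)
  also have "(u + p * step u v) mod p = u" using assms by simp
  finally show "(v + minus_one * step u v mod p) mod p = u" .
qed (use assms p_gt_2 in auto)

lemma in_cay_iff: "(u, v) \<in> parcs (cay S) \<longleftrightarrow> u < p \<and> v < p \<and> step u v \<in> S"
  by (simp add: cay_def)

lemma pverts_cay [simp]: "pverts (cay S) = {..<p}"
  by (simp add: cay_def)

lemma arc_from_0_iff: "S \<subseteq> U \<Longrightarrow> (0, s) \<in> parcs (cay S) \<longleftrightarrow> s \<in> S"
  using p_gt_2 by (auto simp: in_cay_iff)

lemma cay_eq_iff: "S \<subseteq> U \<Longrightarrow> T \<subseteq> U \<Longrightarrow> cay S = cay T \<longleftrightarrow> S = T"
  using arc_from_0_iff[of S] arc_from_0_iff[of T] by (metis subsetI subset_antisym)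

lemma inj_on_cay: "inj_on cay (Pow U)"
  by (rule inj_onI) (simp add: cay_eq_iff)

lemma cay_loopfree: "S \<subseteq> U \<Longrightarrow> (u, v) \<in> parcs (cay S) \<Longrightarrow> u \<noteq> v"
  by (metis in_cay_iff step_in_U_iff subsetD)

lemma pair_digraph_cay:
  assumes "S \<subseteq> U"
  shows "pair_digraph (cay S)"
proof unfold_locales
  show "finite (parcs (cay S))"
    by (rule finite_subset[of _ "{..<p} \<times> {..<p}"]) (auto simp: in_cay_iff)
qed (use cay_loopfree[OF assms] in \<open>auto simp: in_cay_iff\<close>)

section \<open>Isomorphisms of circulants of prime order\<close>

text \<open>
  Rotations are the identity outside the vertex set, so that they are permutations of it in the sense of
  \<^const>\<open>permutes\<close>.
\<close>
definition rot :: "nat \<Rightarrow> nat \<Rightarrow> nat" where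
  "rot i v = (if v < p then (v + i) mod p else v)"

lemma rot_less [simp]: "rot i v < p \<longleftrightarrow> v < p"
  by (simp add: rot_def)

lemma rot_rot: "rot i \<circ> rot j = rot (i + j)"
  by (rule ext) (simp add: rot_def mod_simps ac_simps)

lemma rot_mod: "rot (i mod p) = rot i"
  by (rule ext) (simp add: rot_def mod_simps)

lemma rot_multiple: "p dvd i \<Longrightarrow> rot i = id"
  by (rule ext) (auto simp: rot_def)

lemma rot_inverse: "rot (i * (p - 1)) \<circ> rot i = id" "rot i \<circ> rot (i * (p - 1)) = id"
proof -
  have "i * (p - 1) + i = i * p" using p_gt_2 by (simp add: algebra_simps)
  then show "rot (i * (p - 1)) \<circ> rot i = id" "rot i \<circ> rot (i * (p - 1)) = id"
    by (simp_all add: rot_rot rot_multiple add.commute)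
qed

lemma rot_permutes: "rot i permutes {..<p}"
proof (rule bij_imp_permutes)
  have "inj_on (rot i) {..<p}"
    by (rule inj_on_inverseI[of _ "rot (i * (p - 1))"]) (rule pointfree_idE[OF rot_inverse(1)])
  then show "bij_betw (rot i) {..<p} {..<p}"
    unfolding bij_betw_def by (intro conjI endo_inj_surj) auto
qed (simp add: rot_def)

lemma step_rot: "u < p \<Longrightarrow> v < p \<Longrightarrow> step (rot i u) (rot i v) = step u v"
  using step_affine[of u v 1 i] by (simp add: rot_def)

lemma rot_in_isos: "rot i \<in> isos (parcs (cay S)) (parcs (cay S)) {..<p}"
proof -
  have "map_prod (rot i) (rot i) ` parcs (cay S) = parcs (cay S)"
  proof (intro subset_antisym subsetI)
    fix e assume "e \<in> parcs (cay S)"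
    then obtain u v where e: "e = (u, v)" "u < p" "v < p" "step u v \<in> S"
      by (cases e) (auto simp: in_cay_iff)
    obtain u' v' where "u' < p" "v' < p" "u = rot i u'" "v = rot i v'"
      using e(2,3) permutes_image[OF rot_permutes[of i]] by (metis imageE lessThan_iff)
    with e show "e \<in> map_prod (rot i) (rot i) ` parcs (cay S)"
      by (intro image_eqI[of _ _ "(u', v')"]) (auto simp: in_cay_iff step_rot)
  qed (auto simp: in_cay_iff step_rot)
  then show ?thesis using rot_permutes by (simp add: isos_def)
qed

text \<open>
  By rotation invariance, whether \<open>(u, v)\<close> is an arc is decided by the arc from \<open>0\<close> to \<open>v - u\<close>.
\<close>
lemma circulant_iff: "circulant p G \<longleftrightarrow> (\<exists>S \<subseteq> U. G = cay S)"
proof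
  have shift: "(\<lambda>(u, v). ((u + 1) mod p, (v + 1) mod p)) ` A = map_prod (rot 1) (rot 1) ` A"
    if "A \<subseteq> {..<p} \<times> {..<p}" for A
    using that by (intro image_cong) (auto simp: rot_def)
  {
    assume "\<exists>S \<subseteq> U. G = cay S"
    then obtain S where S: "S \<subseteq> U" "G = cay S" by blast
    have "parcs G \<subseteq> {..<p} \<times> {..<p}" by (auto simp: S in_cay_iff)
    then show "circulant p G"
      using pair_digraph_cay[OF S(1)] rot_in_isos[of 1 S] shift[of "parcs G"]
      by (simp add: circulant_def S(2) isos_def)
  next
    assume G: "circulant p G"
    then interpret pair_digraph G by (simp add: circulant_def)
    have V: "pverts G = {..<p}" using G by (simp add: circulant_def)
    have E: "parcs G \<subseteq> {..<p} \<times> {..<p}" using in_arcsD1 in_arcsD2 V by auto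
    have im: "map_prod (rot 1) (rot 1) ` parcs G = parcs G"
      using G shift[OF E] by (simp add: circulant_def)
    have rot1: "(rot 1 u, rot 1 v) \<in> parcs G \<longleftrightarrow> (u, v) \<in> parcs G" for u v
    proof -
      have "inj (map_prod (rot 1) (rot 1))"
        using permutes_inj[OF rot_permutes] by (intro prod.inj_map)
      from inj_image_mem_iff[OF this, of "(u, v)" "parcs G"] show ?thesis
        unfolding map_prod_simp im .
    qed
    have rotk: "(rot k u, rot k v) \<in> parcs G \<longleftrightarrow> (u, v) \<in> parcs G" for k u v
    proof (induction k)
      case (Suc k)
      have "rot (Suc k) = rot 1 \<circ> rot k" by (simp add: rot_rot)
      with Suc rot1 show ?case by simp
    qed (simp add: rot_multiple)
    define S where "S = {s. (0, s) \<in> parcs G}"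
    have arcs: "(u, v) \<in> parcs G \<longleftrightarrow> step u v \<in> S" if "u < p" "v < p" for u v
      using rotk[of "p - u" u v] that by (simp add: S_def rot_def step_def)
    have "S \<subseteq> U"
      using pair_no_loops[of "(0, 0)"] E by (auto simp: S_def Suc_le_eq intro!: gr0I)
    moreover have "parcs G = parcs (cay S)"
      using E arcs by (auto simp: in_cay_iff)
    with V have "G = cay S" by (simp add: cay_def)
    ultimately show "\<exists>S \<subseteq> U. G = cay S" by blast
  }
qed

text \<open>
  The arithmetic core of the isomorphism criterion. Let \<open>(i, j)\<close> act on isomorphisms \<open>x\<close> by
  \<open>rot i \<circ> x \<circ> rot j\<close>. If all orbits had \<open>p\<^sup>2\<close> elements, then \<open>p\<^sup>2\<close> would divide \<open>p!\<close>. So some \<open>x\<close>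
  satisfies \<open>x (v + b) = x v + a\<close> for residues \<open>a\<close> and \<open>b\<close> that are not both zero, hence both nonzero;
  as \<open>b\<close> generates the residues, \<open>x\<close> is affine of slope \<open>a / b\<close>.
\<close>
lemma affine_iso_exists:
  assumes "isos (parcs (cay S)) (parcs (cay T)) {..<p} \<noteq> {}" (is "?X \<noteq> {}")
  shows "\<exists>g\<in>?X. \<exists>a\<in>U. \<exists>b. \<forall>v<p. g v = (a * v + b) mod p"
proof -
  have fin: "finite ?X"
    by (rule finite_subset[OF _ finite_permutations[of "{..<p}"]]) (auto simp: isos_def)
  have perm: "x permutes {..<p}" if "x \<in> ?X" for x using that by (simp add: isos_def)
  define orbit where "orbit x = {rot i \<circ> x \<circ> rot j | i j. True}" for x :: "nat \<Rightarrow> nat"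
  have orbit_X: "orbit x \<subseteq> ?X" if "x \<in> ?X" for x
    unfolding orbit_def using isos_comp[OF rot_in_isos isos_comp[OF that rot_in_isos]]
    by (auto simp: comp_assoc)
  have orbit_self: "x \<in> orbit x" for x
    unfolding orbit_def using rot_multiple[of 0] by (auto intro!: exI[of _ 0])
  have orbit_sub: "orbit z \<subseteq> orbit x" if "z \<in> orbit x" for x z
  proof -
    obtain i j where z: "z = rot i \<circ> x \<circ> rot j" using \<open>z \<in> orbit x\<close> by (auto simp: orbit_def)
    have "rot k \<circ> z \<circ> rot l = rot (k + i) \<circ> x \<circ> rot (j + l)" for k l
      unfolding z rot_rot[symmetric] by (simp add: comp_assoc)
    then show ?thesis unfolding orbit_def by blast
  qed
  have orbit_sym: "x \<in> orbit z" if "z \<in> orbit x" for x z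
  proof -
    obtain i j where z: "z = rot i \<circ> x \<circ> rot j" using \<open>z \<in> orbit x\<close> by (auto simp: orbit_def)
    have "rot (i * (p - 1)) \<circ> z \<circ> rot (j * (p - 1))
        = (rot (i * (p - 1)) \<circ> rot i) \<circ> x \<circ> (rot j \<circ> rot (j * (p - 1)))"
      unfolding z by (simp only: comp_assoc)
    also have "\<dots> = x" unfolding rot_inverse by simp
    finally show ?thesis unfolding orbit_def by blast
  qed
  have orbit_eq: "orbit x = orbit y" if "z \<in> orbit x" "z \<in> orbit y" for x y z
    using orbit_sub[OF that(1)] orbit_sub[OF that(2)] orbit_sub[OF orbit_sym[OF that(1)]] orbit_sub[OF orbit_sym[OF that(2)]]
    by blast
  let ?I = "{..<p} \<times> {..<p}"
  have orbit_image: "orbit x = (\<lambda>(i, j). rot i \<circ> x \<circ> rot j) ` ?I" for x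
  proof -
    have "rot i \<circ> x \<circ> rot j \<in> (\<lambda>(i, j). rot i \<circ> x \<circ> rot j) ` ?I" for i j
      using p_gt_2 by (intro image_eqI[of _ _ "(i mod p, j mod p)"]) (auto simp: rot_mod)
    then show ?thesis unfolding orbit_def by auto
  qed
  \<comment> \<open>The prime \<open>p\<close> divides \<open>p!\<close> only once.\<close>
  have "\<exists>x\<in>?X. \<not> inj_on (\<lambda>(i, j). rot i \<circ> x \<circ> rot j) ?I"
  proof (rule ccontr)
    assume "\<not> ?thesis"
    then have card_O: "card (orbit x) = p * p" if "x \<in> ?X" for x
      using that by (simp add: orbit_image card_image)
    have "\<Union>(orbit ` ?X) = ?X" using orbit_X orbit_self by blast
    moreover have "p * p dvd card (\<Union>(orbit ` ?X))"
    proof (rule dvd_partition)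
      show "finite (\<Union>(orbit ` ?X))" using calculation fin by simp
      show "\<forall>c\<in>orbit ` ?X. p * p dvd card c" using card_O by simp
      show "\<forall>c1\<in>orbit ` ?X. \<forall>c2\<in>orbit ` ?X. c1 \<noteq> c2 \<longrightarrow> c1 \<inter> c2 = {}" using orbit_eq by blast
    qed
    ultimately have "p * p dvd card ?X" by simp
    moreover have "card ?X dvd fact p"
      using assms card_isos_dvd_fact[of "{..<p}"] by fastforce
    ultimately have "p * p dvd fact p" by (rule dvd_trans)
    also have "fact p = p * fact (p - 1)" using p_gt_2 by (simp add: fact_reduce)
    finally have "p dvd fact (p - 1)" using p_gt_2 by simp
    then show False using prime_p p_gt_2 by (simp add: prime_dvd_fact_iff)
  qed
  then obtain x i j i' j' where x: "x \<in> ?X" and ij: "i < p" "j < p" "i' < p" "j' < p"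
    and neq: "(i, j) \<noteq> (i', j')" and eq: "rot i \<circ> x \<circ> rot j = rot i' \<circ> x \<circ> rot j'"
    unfolding inj_on_def by auto
  have x_less: "x v < p" if "v < p" for v
    using permutes_in_image[OF perm[OF x], of v] that by simp
  define a b where "a = step i' i" and "b = step j j'"
  have shift: "x ((v + b) mod p) = (x v + a) mod p" if v: "v < p" for v
  proof -
    let ?w = "(v + (p - j)) mod p"
    \<comment> \<open>The collision of the pairs \<open>(i, j)\<close> and \<open>(i', j')\<close> is evaluated at \<open>v - j\<close>.\<close>
    have w: "?w < p" "(?w + j) mod p = v" "(?w + j') mod p = (v + b) mod p"
      using v ij p_gt_2 by (simp_all add: b_def step_def mod_simps ac_simps)
    have "(x v + i) mod p = (x ((v + b) mod p) + i') mod p"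
      using fun_cong[OF eq, of ?w] w v x_less p_gt_2 by (simp add: rot_def)
    moreover have "(x v + a) mod p = ((x v + i) mod p + (p - i')) mod p"
      by (simp add: a_def step_def mod_simps ac_simps)
    ultimately have "(x v + a) mod p = ((x ((v + b) mod p) + i') mod p + (p - i')) mod p"
      by simp
    also have "\<dots> = (x ((v + b) mod p) + (i' + (p - i'))) mod p"
      unfolding mod_add_left_eq add.assoc ..
    also have "\<dots> = x ((v + b) mod p)" using ij x_less p_gt_2 by simp
    finally show ?thesis ..
  qed
  have ab: "a < p" "b < p" by (simp_all add: a_def b_def)
  have a0: "a = 0" if "b = 0"
  proof -
    have "(x 0 + a) mod p = x 0" using shift[of 0] that p_gt_2 by simp
    then have "step (x 0) (x 0) = a" using ab x_less[of 0] p_gt_2 by (intro step_eqI) auto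
    then show ?thesis using step_eq_0_iff[of "x 0" "x 0"] x_less[of 0] p_gt_2 by simp
  qed
  have "b \<noteq> 0"
    using a0 neq ij step_eq_0_iff by (auto simp: a_def b_def)
  moreover have "a \<noteq> 0"
  proof
    assume "a = 0"
    then have "x b = x 0" using shift[of 0] ab x_less[of 0] p_gt_2 by simp
    with permutes_inj[OF perm[OF x]] \<open>b \<noteq> 0\<close> show False by (simp add: inj_eq)
  qed
  ultimately have "a \<in> U" "b \<in> U" using ab by auto
  then obtain c where c: "c \<in> U" "[b * c = 1] (mod p)" using inverse_U coprime_U by metis
  have mult: "x (k * b mod p) = (x 0 + k * a) mod p" for k
  proof (induction k)
    case 0
    show ?case using x_less[of 0] p_gt_2 by simp
  next
    case (Suc k)
    have "x (Suc k * b mod p) = x ((k * b mod p + b) mod p)" by (simp add: mod_simps ac_simps)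
    also have "\<dots> = (x (k * b mod p) + a) mod p" using p_gt_2 by (intro shift) simp
    also have "\<dots> = (x 0 + Suc k * a) mod p" unfolding Suc by (simp add: mod_simps ac_simps)
    finally show ?case .
  qed
  show ?thesis
  proof (intro bexI[OF _ x] bexI[of _ "c * a mod p"] exI[of _ "x 0"] allI impI)
    show "c * a mod p \<in> U" using c(1) \<open>a \<in> U\<close> coprime_U mult_in_U by blast
    fix v assume v: "v < p"
    have "[v * (b * c) = v * 1] (mod p)" using c(2) by (rule cong_mult[OF cong_refl])
    then have "v * c * b mod p = v" using v by (simp add: cong_def ac_simps)
    moreover have "(c * a mod p * v + x 0) mod p = (c * a * v + x 0) mod p"
      by (metis mod_add_left_eq mod_mult_left_eq)
    ultimately show "x v = (c * a mod p * v + x 0) mod p"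
      using mult[of "v * c"] by (simp add: ac_simps)
  qed
qed

text \<open>
  Differences of an affine isomorphism of slope \<open>a\<close> are multiplied by \<open>a\<close>, so it carries \<open>S\<close> to \<open>a S\<close>.
\<close>
lemma isomorphic_cay_iff:
  assumes S: "S \<subseteq> U" and T: "T \<subseteq> U"
  shows "isomorphic (cay S) (cay T) \<longleftrightarrow> (\<exists>a\<in>U. dilate a S = T)"
proof -
  have wf: "pair_wf_digraph (cay S)"
    using pair_digraph_cay[OF S] by (simp add: pair_digraph_def pair_fin_digraph_def)
  show ?thesis unfolding isomorphic_iff[OF wf] pverts_cay
  proof
    assume "\<exists>f. bij_betw f {..<p} {..<p} \<and>
      parcs (cay T) = (\<lambda>(u, v). (f u, f v)) ` parcs (cay S)"
    then obtain f where f: "bij_betw f {..<p} {..<p}"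
      "parcs (cay T) = (\<lambda>(u, v). (f u, f v)) ` parcs (cay S)" by blast
    define h where "h v = (if v < p then f v else v)" for v
    have "bij_betw h {..<p} {..<p}" using f(1) by (subst bij_betw_cong[of _ h f]) (simp_all add: h_def)
    then have "h permutes {..<p}" by (rule bij_imp_permutes) (simp add: h_def)
    moreover have "map_prod h h ` parcs (cay S) = parcs (cay T)"
      unfolding f(2) by (rule image_cong) (auto simp: in_cay_iff h_def)
    ultimately have "isos (parcs (cay S)) (parcs (cay T)) {..<p} \<noteq> {}" by (auto simp: isos_def)
    from affine_iso_exists[OF this]
    obtain g a b where g: "g \<in> isos (parcs (cay S)) (parcs (cay T)) {..<p}"
      and a: "a \<in> U" and affine: "\<forall>v<p. g v = (a * v + b) mod p"
      by blast
    have cop: "coprime a p" using a by (rule coprime_U)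
    have "inj (map_prod g g)"
      using g by (intro prod.inj_map) (auto simp: isos_def dest: permutes_inj)
    have mem: "a * s mod p \<in> T \<longleftrightarrow> s \<in> S" if s: "s \<in> U" for s
    proof -
      have "s \<in> S \<longleftrightarrow> (0, s) \<in> parcs (cay S)" using arc_from_0_iff[OF S] by simp
      also have "\<dots> \<longleftrightarrow> (g 0, g s) \<in> parcs (cay T)"
        using inj_image_mem_iff[OF \<open>inj (map_prod g g)\<close>, of "(0, s)" "parcs (cay S)"] g
        by (simp add: isos_def)
      also have "\<dots> \<longleftrightarrow> a * s mod p \<in> T"
        using step_affine[of 0 s a b] affine s by (simp add: in_cay_iff)
      finally show ?thesis ..
    qed
    have "dilate a S = T"
    proof (intro subset_antisym subsetI)
      fix t assume t: "t \<in> T"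
      then have "t \<in> (\<lambda>s. a * s mod p) ` U" using T bij_betw_mult[OF cop] by (auto simp: bij_betw_def)
      with mem t show "t \<in> dilate a S" unfolding dilate_def by blast
    qed (use mem S in \<open>auto simp: dilate_def\<close>)
    with a show "\<exists>a\<in>U. dilate a S = T" by blast
  next
    assume "\<exists>a\<in>U. dilate a S = T"
    then obtain a where a: "a \<in> U" "dilate a S = T" by blast
    have cop: "coprime a p" using a(1) by (rule coprime_U)
    let ?f = "\<lambda>u. a * u mod p"
    have inj: "inj_on ?f {..<p}" using cop by (rule inj_on_mult)
    have surj: "?f ` {..<p} = {..<p}" using inj p_gt_2 by (intro endo_inj_surj) auto
    have step: "step (?f u) (?f v) = ?f (step u v)" if "u < p" "v < p" for u v
      using step_affine[OF that, of a 0] by simp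
    have "parcs (cay T) = (\<lambda>(u, v). (?f u, ?f v)) ` parcs (cay S)"
    proof (intro subset_antisym subsetI)
      fix e assume "e \<in> parcs (cay T)"
      moreover from this have "fst e \<in> ?f ` {..<p}" "snd e \<in> ?f ` {..<p}"
        unfolding surj by (cases e; simp add: in_cay_iff)+
      ultimately obtain u v
        where e: "e = (?f u, ?f v)" "(?f u, ?f v) \<in> parcs (cay T)" "u < p" "v < p"
        by (cases e) auto
      then have "u \<noteq> v" using cay_loopfree[OF T] by blast
      then have "step u v \<in> U" using e(3,4) step_in_U_iff by blast
      then have "step u v \<in> S"
        using e mult_mem_dilate_iff[OF cop S] by (simp add: in_cay_iff step a(2))
      with e show "e \<in> (\<lambda>(u, v). (?f u, ?f v)) ` parcs (cay S)"
        by (intro image_eqI[of _ _ "(u, v)"]) (auto simp: in_cay_iff)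
    next
      fix e assume "e \<in> (\<lambda>(u, v). (?f u, ?f v)) ` parcs (cay S)"
      then obtain u v where e: "e = (?f u, ?f v)" "u < p" "v < p" "step u v \<in> S"
        by (auto simp: in_cay_iff)
      then have "step (?f u) (?f v) \<in> T" by (simp add: step a(2)[symmetric] dilate_def)
      with e p_gt_2 show "e \<in> parcs (cay T)" by (simp add: in_cay_iff)
    qed
    with inj surj show "\<exists>f. bij_betw f {..<p} {..<p} \<and>
      parcs (cay T) = (\<lambda>(u, v). (f u, f v)) ` parcs (cay S)"
      by (intro exI[of _ ?f]) (simp add: bij_betw_def)
  qed
qed

lemma complement_cay: "S \<subseteq> U \<Longrightarrow> digraph_complement (cay S) = cay (U - S)"
  using step_in_U_iff by (auto simp: digraph_complement_def cay_def)

lemma in_cay_swap_iff: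
  assumes S: "S \<subseteq> U"
  shows "(v, u) \<in> parcs (cay S) \<longleftrightarrow> (u, v) \<in> parcs (cay (dilate minus_one S))"
proof (cases "u < p \<and> v < p \<and> u \<noteq> v")
  case True
  then have "step u v \<in> U" using step_in_U_iff by blast
  from mult_mem_dilate_iff[OF coprime_neg dilate_subset[OF coprime_neg S] this]
  have "minus_one * step u v mod p \<in> S \<longleftrightarrow> step u v \<in> dilate minus_one S" unfolding dilate_neg_neg[OF S] .
  moreover have "step v u = minus_one * step u v mod p" using True by (intro step_swap) auto
  ultimately have "step v u \<in> S \<longleftrightarrow> step u v \<in> dilate minus_one S" by simp
  with True show ?thesis by (simp add: in_cay_iff)
next
  case False
  then show ?thesis
    using cay_loopfree[OF S] cay_loopfree[OF dilate_subset[OF coprime_neg S]] by (auto simp: in_cay_iff)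
qed

lemma symmetric_cay_iff:
  assumes S: "S \<subseteq> U"
  shows "symmetric (with_proj (cay S)) \<longleftrightarrow> dilate minus_one S = S"
proof -
  have "(parcs (cay S))\<inverse> = parcs (cay (dilate minus_one S))"
    using in_cay_swap_iff[OF S] by auto
  then have "symmetric (with_proj (cay S)) \<longleftrightarrow> cay (dilate minus_one S) = cay S"
    by (simp add: symmetric_def sym_conv_converse_eq) (simp add: cay_def)
  also have "\<dots> \<longleftrightarrow> dilate minus_one S = S" by (intro cay_eq_iff dilate_subset coprime_neg S)
  finally show ?thesis .
qed

lemma tournament_cay_iff:
  assumes S: "S \<subseteq> U"
  shows "tournament (cay S) \<longleftrightarrow> dilate minus_one S = U - S"
proof -
  have sub: "dilate minus_one S \<subseteq> U" by (intro dilate_subset coprime_neg S)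
  have "tournament (cay S) \<longleftrightarrow>
      (\<forall>u<p. \<forall>v<p. u \<noteq> v \<longrightarrow> ((u, v) \<in> parcs (cay S)) \<noteq> ((u, v) \<in> parcs (cay (dilate minus_one S))))"
    unfolding tournament_def in_cay_swap_iff[OF S] using pair_digraph_cay[OF S] by auto
  also have "\<dots> \<longleftrightarrow> (\<forall>u<p. \<forall>v<p. step u v \<in> U \<longrightarrow> (step u v \<in> S) \<noteq> (step u v \<in> dilate minus_one S))"
    using step_in_U_iff by (auto simp: in_cay_iff)
  also have "\<dots> \<longleftrightarrow> (\<forall>s\<in>U. (s \<in> S) \<noteq> (s \<in> dilate minus_one S))"
  proof (intro iffI ballI)
    fix s assume *: "\<forall>u<p. \<forall>v<p. step u v \<in> U \<longrightarrow> (step u v \<in> S) \<noteq> (step u v \<in> dilate minus_one S)"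
      and s: "s \<in> U"
    then have "s < p" "step 0 s \<in> U" by simp_all
    with * have "(step 0 s \<in> S) \<noteq> (step 0 s \<in> dilate minus_one S)" using p_gt_2 by blast
    then show "(s \<in> S) \<noteq> (s \<in> dilate minus_one S)" using s by simp
  qed blast
  also have "\<dots> \<longleftrightarrow> dilate minus_one S = U - S" using S sub by blast
  finally show ?thesis .
qed

section \<open>Orbits of connection sets\<close>

definition complementable :: "nat set set" where
  "complementable = (\<Union>a\<in>U. complemented_by a)"

lemma self_complementary_cay_iff: "S \<subseteq> U \<Longrightarrow> self_complementary (cay S) \<longleftrightarrow> S \<in> complementable"
  by (simp add: self_complementary_def complement_cay isomorphic_cay_iff complementable_def complemented_by_def)

definition orb :: "nat set \<Rightarrow> nat set set" where "orb S = (\<lambda>a. dilate a S) ` U"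

lemma orb_dilate:
  assumes "a \<in> U"
  shows "orb (dilate a S) = orb S"
proof -
  have "orb (dilate a S) = (\<lambda>c. dilate c S) ` (\<lambda>c. a * c mod p) ` U"
    unfolding orb_def image_image dilate_mod by (simp add: dilate_mult dilate_commute[of a])
  also have "(\<lambda>c. a * c mod p) ` U = U"
    using bij_betw_mult[OF coprime_U[OF assms]] by (simp add: bij_betw_def)
  finally show ?thesis by (simp add: orb_def)
qed

text \<open>
  The residues that map \<open>S\<close> to \<open>b S\<close> form a coset of the stabilizer of \<open>S\<close>.
\<close>
lemma card_transporter:
  assumes S: "S \<subseteq> U" and b: "b \<in> U"
  shows "card {a \<in> U. dilate a S = dilate b S} = card {a \<in> U. dilate a S = S}"
proof -
  let ?f = "\<lambda>c. b * c mod p"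
  have cop: "coprime b p" using b by (rule coprime_U)
  have bij: "bij_betw ?f U U" using cop by (rule bij_betw_mult)
  have im: "?f ` {a \<in> U. dilate a S = S} = {a \<in> U. dilate a S = dilate b S}"
  proof (intro subset_antisym subsetI)
    fix d assume "d \<in> {a \<in> U. dilate a S = dilate b S}"
    then have d: "d \<in> U" "dilate d S = dilate b S" by auto
    have "d \<in> ?f ` U" unfolding bij_betw_imp_surj_on[OF bij] by (rule d(1))
    then obtain c where c: "c \<in> U" "d = ?f c" by blast
    then have "dilate b (dilate c S) = dilate b S" using d(2) by (simp add: dilate_mult)
    then have "dilate c S = S"
      using dilate_eq_iff[OF cop dilate_subset[OF coprime_U[OF c(1)] S] S] by simp
    with c show "d \<in> ?f ` {a \<in> U. dilate a S = S}" by blast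
  next
    fix d assume "d \<in> ?f ` {a \<in> U. dilate a S = S}"
    then show "d \<in> {a \<in> U. dilate a S = dilate b S}"
      using mult_in_U[OF cop] by (auto simp only: mem_Collect_eq dilate_mult dilate_mod)
  qed
  have "inj_on ?f {a \<in> U. dilate a S = S}"
    using bij_betw_imp_inj_on[OF bij] by (rule inj_on_subset) blast
  from card_image[OF this] show ?thesis unfolding im .
qed

text \<open>
  As \<open>U\<close> is commutative, all members of an orbit have the same stabilizer. Its size is also the number
  of residues that map \<open>S\<close> to any given member, and these numbers add up to the size of \<open>U\<close>.
\<close>
lemma sum_stabilizers_orb:
  assumes S: "S \<subseteq> U"
  shows "(\<Sum>T\<in>orb S. card {a \<in> U. dilate a T = T}) = p - 1"
proof -
  have "p - 1 = (\<Sum>a\<in>U. 1)" by simp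
  also have "\<dots> = (\<Sum>T\<in>orb S. \<Sum>a | a \<in> U \<and> dilate a S = T. 1)"
    unfolding orb_def by (rule sum.image_gen) simp
  also have "\<dots> = (\<Sum>T\<in>orb S. card {a \<in> U. dilate a T = T})"
  proof (rule sum.cong[OF refl])
    fix T assume "T \<in> orb S"
    then obtain b where b: "b \<in> U" "T = dilate b S" by (auto simp: orb_def)
    have "dilate a T = T \<longleftrightarrow> dilate a S = S" if "a \<in> U" for a
      unfolding b(2) dilate_commute[of a b]
      using that b(1) S by (intro dilate_eq_iff dilate_subset coprime_U)
    then have "{a \<in> U. dilate a T = T} = {a \<in> U. dilate a S = S}" by blast
    with card_transporter[OF S b(1)]
    show "(\<Sum>a | a \<in> U \<and> dilate a S = T. 1) = card {a \<in> U. dilate a T = T}" by (simp add: b(2))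
  qed
  finally show ?thesis ..
qed

lemma num_iso_classes_cay:
  assumes F: "F \<subseteq> Pow U" and closed: "\<And>a S. a \<in> U \<Longrightarrow> S \<in> F \<Longrightarrow> dilate a S \<in> F"
  shows "(p - 1) * num_iso_classes (cay ` F) = (\<Sum>S\<in>F. card {a \<in> U. dilate a S = S})"
proof -
  let ?R = "{(G, H). G \<in> cay ` F \<and> H \<in> cay ` F \<and> isomorphic G H}"
  have orb_F: "orb S \<subseteq> F" if "S \<in> F" for S using closed that by (auto simp: orb_def)
  have self: "S \<in> orb S" if "S \<in> F" for S
    using dilate_1[of S] F that p_gt_2 by (force simp: orb_def intro!: image_eqI[of _ _ 1])
  have iso_class: "?R `` {cay S} = cay ` orb S" if S: "S \<in> F" for S
  proof -
    have "isomorphic (cay S) (cay T) \<longleftrightarrow> T \<in> orb S" if "T \<in> F" for T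
      using S that F isomorphic_cay_iff[of S T] by (auto simp: orb_def)
    then show ?thesis using S orb_F[OF S] by auto
  qed
  have "cay ` F // ?R = (\<lambda>S. ?R `` {cay S}) ` F" by (auto simp: quotient_def)
  also have "\<dots> = (`) cay ` orb ` F" unfolding image_image using iso_class by (intro image_cong refl)
  finally have "num_iso_classes (cay ` F) = card ((`) cay ` orb ` F)"
    by (simp add: num_iso_classes_def)
  also have "\<dots> = card (orb ` F)"
  proof (rule card_image, rule inj_on_image, rule inj_on_subset[OF inj_on_cay])
    show "\<Union>(orb ` F) \<subseteq> Pow U" using orb_F F by blast
  qed
  finally have num: "num_iso_classes (cay ` F) = card (orb ` F)" .
  have finF: "finite F" using F by (rule finite_subset) simp
  have "\<Union>(orb ` F) = F" using orb_F self by blast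
  then have "(\<Sum>S\<in>F. card {a \<in> U. dilate a S = S}) = (\<Sum>S\<in>\<Union>(orb ` F). card {a \<in> U. dilate a S = S})"
    by simp
  also have "\<dots> = (\<Sum>Q\<in>orb ` F. \<Sum>S\<in>Q. card {a \<in> U. dilate a S = S})"
  proof (subst sum.Union_disjoint)
    show "\<forall>A\<in>orb ` F. finite A" by (auto simp: orb_def)
    have "orb Q = orb S" if Q: "Q \<in> orb S" for Q S
    proof -
      obtain a where "a \<in> U" "Q = dilate a S" using Q unfolding orb_def by blast
      then show ?thesis by (simp only: orb_dilate)
    qed
    then show "\<forall>A\<in>orb ` F. \<forall>B\<in>orb ` F. A \<noteq> B \<longrightarrow> A \<inter> B = {}" by blast
  qed simp
  also have "\<dots> = (\<Sum>Q\<in>orb ` F. p - 1)"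
  proof (rule sum.cong[OF refl])
    fix Q assume "Q \<in> orb ` F"
    then obtain S where "S \<subseteq> U" "Q = orb S" using F by blast
    then show "(\<Sum>S\<in>Q. card {a \<in> U. dilate a S = S}) = p - 1" using sum_stabilizers_orb by simp
  qed
  finally show ?thesis by (simp add: num)
qed

lemma dilate_in_fixed_by: "S \<in> fixed_by b \<Longrightarrow> a \<in> U \<Longrightarrow> dilate a S \<in> fixed_by b"
  using dilate_subset[OF coprime_U] by (simp add: fixed_by_def dilate_commute[of b])

lemma dilate_in_complemented_by: "S \<in> complemented_by b \<Longrightarrow> a \<in> U \<Longrightarrow> dilate a S \<in> complemented_by b"
  using dilate_subset[OF coprime_U] dilate_compl[OF coprime_U] by (simp add: complemented_by_def dilate_commute[of b])

lemma dilate_in_complementable: "S \<in> complementable \<Longrightarrow> a \<in> U \<Longrightarrow> dilate a S \<in> complementable"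
  unfolding complementable_def using dilate_in_complemented_by by blast

text \<open>
  The complement of \<open>S\<close> is a dilate of \<open>S\<close>, so \<open>card_transporter\<close> applies to it.
\<close>
lemma card_stabilizer_complementable:
  assumes "S \<in> complementable"
  shows "card {a \<in> U. dilate a S = S} = card {a \<in> U. S \<in> complemented_by a}"
proof -
  obtain b where b: "b \<in> U" and S: "S \<subseteq> U" "dilate b S = U - S"
    using assms by (auto simp: complementable_def complemented_by_def)
  show ?thesis using card_transporter[OF S(1) b] S by (simp add: complemented_by_def)
qed

section \<open>The enumerators as counts of pairs\<close>

lemma undirected_eq: "{G. circulant p G \<and> symmetric (with_proj G)} = cay ` fixed_by minus_one"
  by (auto simp: circulant_iff symmetric_cay_iff fixed_by_def)

lemma selfcompl_eq: "{G. circulant p G \<and> self_complementary G} = cay ` complementable"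
proof -
  have "complementable \<subseteq> Pow U" by (auto simp: complementable_def complemented_by_def)
  then show ?thesis using self_complementary_cay_iff by (auto simp: circulant_iff)
qed

lemma selfcompl_undirected_eq:
  "{G. circulant p G \<and> symmetric (with_proj G) \<and> self_complementary G} = cay ` (fixed_by minus_one \<inter> complementable)"
  using self_complementary_cay_iff by (auto simp: circulant_iff symmetric_cay_iff fixed_by_def)

lemma tournament_eq: "{G. circulant p G \<and> tournament G} = cay ` complemented_by minus_one"
  by (auto simp: circulant_iff tournament_cay_iff complemented_by_def)

lemma count_undirected: "(p - 1) * C_u p = (\<Sum>a\<in>U. card (fixed_by minus_one \<inter> fixed_by a))"
proof -
  have "(p - 1) * C_u p = (\<Sum>S\<in>fixed_by minus_one. card {a \<in> U. dilate a S = S})"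
    unfolding C_u_def undirected_eq by (rule num_iso_classes_cay) (auto simp: dilate_in_fixed_by, auto simp: fixed_by_def)
  also have "\<dots> = (\<Sum>a\<in>U. card {S \<in> fixed_by minus_one. dilate a S = S})"
    by (rule sum_card_swap) (simp_all add: finite_fixed_by)
  also have "\<dots> = (\<Sum>a\<in>U. card (fixed_by minus_one \<inter> fixed_by a))"
    by (intro sum.cong refl arg_cong[of _ _ card]) (auto simp: fixed_by_def)
  finally show ?thesis .
qed

lemma sum_stabilizers_complementable:
  assumes "F \<subseteq> Pow U"
  shows "(\<Sum>S\<in>F \<inter> complementable. card {a \<in> U. dilate a S = S}) = (\<Sum>a\<in>U. card (F \<inter> complemented_by a))"
proof -
  have fin: "finite F" using assms by (rule finite_subset) simp
  have "(\<Sum>S\<in>F \<inter> complementable. card {a \<in> U. dilate a S = S}) =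
      (\<Sum>S\<in>F \<inter> complementable. card {a \<in> U. S \<in> complemented_by a})"
    by (intro sum.cong refl card_stabilizer_complementable) auto
  also have "\<dots> = (\<Sum>a\<in>U. card {S \<in> F \<inter> complementable. S \<in> complemented_by a})"
    by (rule sum_card_swap) (simp_all add: fin)
  also have "\<dots> = (\<Sum>a\<in>U. card (F \<inter> complemented_by a))"
    by (intro sum.cong refl arg_cong[of _ _ card]) (auto simp: complementable_def)
  finally show ?thesis .
qed

lemma count_selfcompl: "(p - 1) * C_sd p = (\<Sum>a\<in>U. card (complemented_by a))"
proof -
  have complementable: "complementable \<subseteq> Pow U" by (auto simp: complementable_def complemented_by_def)
  have "(p - 1) * C_sd p = (\<Sum>S\<in>Pow U \<inter> complementable. card {a \<in> U. dilate a S = S})"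
    unfolding C_sd_def selfcompl_eq Int_absorb1[OF complementable]
    using complementable dilate_in_complementable by (rule num_iso_classes_cay)
  also have "\<dots> = (\<Sum>a\<in>U. card (Pow U \<inter> complemented_by a))" by (rule sum_stabilizers_complementable) simp
  also have "\<dots> = (\<Sum>a\<in>U. card (complemented_by a))"
    by (intro sum.cong refl arg_cong[of _ _ card]) (auto simp: complemented_by_def)
  finally show ?thesis .
qed

lemma count_selfcompl_undirected: "(p - 1) * C_su p = (\<Sum>a\<in>U. card (fixed_by minus_one \<inter> complemented_by a))"
proof -
  have fixed_by: "fixed_by minus_one \<subseteq> Pow U" by (auto simp: fixed_by_def)
  have "(p - 1) * C_su p = (\<Sum>S\<in>fixed_by minus_one \<inter> complementable. card {a \<in> U. dilate a S = S})"
    unfolding C_su_def selfcompl_undirected_eq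
    by (rule num_iso_classes_cay) (use fixed_by dilate_in_fixed_by dilate_in_complementable in auto)
  also have "\<dots> = (\<Sum>a\<in>U. card (fixed_by minus_one \<inter> complemented_by a))" using fixed_by by (rule sum_stabilizers_complementable)
  finally show ?thesis .
qed

lemma enumerator_identity: "2 * C_sd p = C_u p + C_su p"
proof -
  have "(p - 1) * (2 * C_sd p) = 2 * ((p - 1) * C_sd p)" by (simp only: ac_simps)
  also have "\<dots> = (p - 1) * (C_u p + C_su p)"
    unfolding distrib_left count_selfcompl count_undirected count_selfcompl_undirected
    by (rule sum_complemented_by_fixed_by)
  finally show ?thesis using p_gt_2 by simp
qed

text \<open>
  If \<open>a\<close> complements some set, its order is even. It divides \<open>p - 1\<close> and so is not a multiple of \<open>4\<close>; the
  half power of \<open>a\<close>, which is \<open>-1\<close>, has an odd exponent and complements the same set.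
\<close>
lemma complementable_eq_complemented_by_neg:
  assumes "p mod 4 = 3"
  shows "complementable = complemented_by minus_one"
proof
  show "complemented_by minus_one \<subseteq> complementable" unfolding complementable_def using neg_in_U by blast
  show "complementable \<subseteq> complemented_by minus_one"
  proof
    fix S assume "S \<in> complementable"
    then obtain a where a: "a \<in> U" and S: "S \<in> complemented_by a" by (auto simp: complementable_def)
    have "a \<notin> odd_order" using S complemented_by_odd_order by blast
    then have ev: "even (ord p a)" using a by (intro even_order) blast
    have "ord p a dvd p - 1"
      using order_divides_totient[of p a] coprime_U[OF a] prime_p
      by (simp add: coprime_commute totient_prime)
    moreover have "\<not> 4 dvd p - 1" using assms by presburger
    ultimately have "\<not> 4 dvd ord p a" using dvd_trans by blast
    with ev have "odd (ord p a div 2)" by presburger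
    with half_order[OF a ev] a have "a \<in> neg_odd_power" by (auto simp: neg_odd_power_def)
    with S complemented_by_neg_odd_power show "S \<in> complemented_by minus_one" by blast
  qed
qed

end

theorem mainTheorem1:
  fixes p :: nat
  assumes "prime p" and "odd p"
  shows "2 * C_sd p = C_u p + C_su p \<and>
         (p mod 4 = 3 \<longrightarrow> C_u p = 2 * C_sd p \<and> 2 * C_sd p = 2 * C_t p)"
proof -
  interpret odd_prime p using assms by unfold_locales
  have "C_u p = 2 * C_sd p \<and> C_sd p = C_t p" if "p mod 4 = 3"
  proof -
    have "C_su p = 0"
      unfolding C_su_def selfcompl_undirected_eq complementable_eq_complemented_by_neg[OF that]
        fixed_by_complemented_by_disjoint
      by (simp add: num_iso_classes_def)
    moreover have "C_sd p = C_t p"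
      unfolding C_sd_def C_t_def selfcompl_eq tournament_eq complementable_eq_complemented_by_neg[OF that] ..
    ultimately show ?thesis using enumerator_identity by simp
  qed
  then show ?thesis using enumerator_identity by metis
qed

end
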